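(* Let $\alpha\in(0,1]$ and suppose $\underline{c}_i\ge\alpha\overline{c}_i$ for each $i\in[n]$. Let $\hat{\mathbf{x}}\in\Phi_1$ be an optimal solution to $$\min_{\mathbf{x}\in\Phi_1}\Big(\mathbf{C}\mathbf{x}+\min_{\mathbf{y}\in\Phi_{\mathbf{x}}}\underline{\mathbf{c}}\mathbf{y}\Big),\qquad \underline{\mathbf{c}}=(\underline{c}_i)_{i\in[n]}.$$ Then $\hat{\mathbf{x}}$ is a $\frac{1}{\alpha}$-approximate solution to the robust two-stage selection problem \textsc{R2ST} under scenario set $\mathcal{U}^d$, that is, $$\mathbf{C}\hat{\mathbf{x}}+\max_{\mathbf{c}\in\mathcal{U}^d}\min_{\mathbf{y}\in\Phi_{\hat{\mathbf{x}}}}\mathbf{c}\mathbf{y}\ \le\ \frac{1}{\alpha}\,\min_{\mathbf{x}\in\Phi_1}\Big(\mathbf{C}\mathbf{x}+\max_{\mathbf{c}\in\mathcal{U}^d}\min_{\mathbf{y}\in\Phi_{\mathbf{x}}}\mathbf{c}\mathbf{y}\Big).$$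
   Context: Let $[n]=\{1,\dots,n\}$ be a set of items and $p\in[n]$. Let $\mathbf{C}=(C_1,\dots,C_n)$ be the vector of first-stage item costs, which are precisely known. The uncertain second-stage cost of item $i\in[n]$ lies in $[\underline{c}_i,\overline{c}_i]$, where $\underline{c}_i$ is its nominal value and $d_i=\overline{c}_i-\underline{c}_i\ge 0$ its maximal deviation; $\Gamma\ge 0$ is a fixed budget. $\mathbf{c}\mathbf{y}$ denotes $\sum_{i\in[n]}c_iy_i$. $\Phi_1=\{\mathbf{x}\in\{0,1\}^n:\sum_{i\in[n]}x_i\le p\}$. For $\mathbf{x}\in\Phi_1$, $\Phi_{\mathbf{x}}=\{\mathbf{y}\in\{0,1\}^n:\sum_{i\in[n]}(x_i+y_i)=p,\ x_i+y_i\le 1\ \text{for all } i\in[n]\}$. The discrete budgeted uncertainty set is $\mathcal{U}^d=\{(\underline{c}_i+\delta_i)_{i\in[n]}:\delta_i\in\{0,d_i\},\ |\{i\in[n]:\delta_i=d_i\}|\le\Gamma\}\subseteq\mathbb{R}^n_+$. \textsc{R2ST} under $\mathcal{U}^d$ is the problem $\min_{\mathbf{x}\in\Phi_1}\big(\mathbf{C}\mathbf{x}+\max_{\mathbf{c}\in\mathcal{U}^d}\min_{\mathbf{y}\in\Phi_{\mathbf{x}}}\mathbf{c}\mathbf{y}\big)$.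
   Formalization: First-stage costs C are assumed nonnegative (the claim fails for n=p=1, C=-1, zero second-stage costs, α=1/2), and items with d_i=0 do not count toward the budget Γ in U^d (otherwise U^d may be empty and the maximum undefined). *)

theory Defs
  imports "HOL-Analysis.Analysis"
begin

(* The items are the elements of the finite index type 'n, so n = CARD('n), and the
   product of a cost vector with a solution is the inner product of real ^ 'n. *)

definition binary_vectors :: "(real ^ 'n) set" where
  "binary_vectors = {x. \<forall>i. x $ i \<in> {0, 1}}"

definition first_stage :: "nat \<Rightarrow> (real ^ 'n) set" where
  "first_stage p = {x \<in> binary_vectors. (\<Sum>i\<in>UNIV. x $ i) \<le> real p}"

definition second_stage :: "nat \<Rightarrow> real ^ 'n \<Rightarrow> (real ^ 'n) set" where
  "second_stage p x =
     {y \<in> binary_vectors. (\<Sum>i\<in>UNIV. x $ i + y $ i) = real p \<and> (\<forall>i. x $ i + y $ i \<le> 1)}"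

(* The budget bounds the number of costs that take their deviated value.  An item with
   d $ i = 0 cannot deviate and uses no budget; without the conjunct d $ i \<noteq> 0 such items
   would always be counted, and the set could be empty.  The conjunct is redundant as soon as
   all d $ i are nonzero: see discrete_uncertainty_pos below. *)
definition discrete_uncertainty :: "real ^ 'n \<Rightarrow> real ^ 'n \<Rightarrow> real \<Rightarrow> (real ^ 'n) set" where
  "discrete_uncertainty c d \<Gamma> =
     {c + \<delta> | \<delta>. (\<forall>i. \<delta> $ i \<in> {0, d $ i}) \<and>
                 real (card {i. \<delta> $ i = d $ i \<and> d $ i \<noteq> 0}) \<le> \<Gamma>}"

definition two_stage_cost :: "nat \<Rightarrow> real ^ 'n \<Rightarrow> real ^ 'n \<Rightarrow> real ^ 'n \<Rightarrow> real" where
  "two_stage_cost p C c x = C \<bullet> x + (MIN y\<in>second_stage p x. c \<bullet> y)"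

definition robust_two_stage_cost ::
    "nat \<Rightarrow> real ^ 'n \<Rightarrow> (real ^ 'n) set \<Rightarrow> real ^ 'n \<Rightarrow> real" where
  "robust_two_stage_cost p C U x = C \<bullet> x + (MAX c\<in>U. MIN y\<in>second_stage p x. c \<bullet> y)"

lemma discrete_uncertainty_pos:
  assumes "\<And>i. d $ i > 0"
  shows "discrete_uncertainty c d \<Gamma> =
     {c + \<delta> | \<delta>. (\<forall>i. \<delta> $ i \<in> {0, d $ i}) \<and> real (card {i. \<delta> $ i = d $ i}) \<le> \<Gamma>}"
proof -
  have "d $ i \<noteq> 0" for i
    using assms[of i] by simp
  then show ?thesis
    by (simp add: discrete_uncertainty_def)
qed

(* All minima and maxima above range over finite nonempty sets, as MIN and MAX require. *)

lemma finite_vec_prod: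
  fixes A :: "'n::finite \<Rightarrow> real set"
  assumes "\<And>i. finite (A i)"
  shows "finite {x :: real ^ 'n. \<forall>i. x $ i \<in> A i}"
proof (rule finite_subset)
  show "{x :: real ^ 'n. \<forall>i. x $ i \<in> A i} \<subseteq> vec_lambda ` Pi\<^sub>E UNIV A"
  proof
    fix x :: "real ^ 'n"
    assume "x \<in> {x. \<forall>i. x $ i \<in> A i}"
    then have "vec_nth x \<in> Pi\<^sub>E UNIV A"
      by auto
    then show "x \<in> vec_lambda ` Pi\<^sub>E UNIV A"
      by (metis imageI vec_nth_inverse)
  qed
  show "finite (vec_lambda ` Pi\<^sub>E UNIV A)"
    using assms by (intro finite_imageI finite_PiE) auto
qed

lemma finite_binary_vectors: "finite (binary_vectors :: (real ^ 'n::finite) set)"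
  unfolding binary_vectors_def by (rule finite_vec_prod) simp

lemma finite_first_stage: "finite (first_stage p :: (real ^ 'n::finite) set)"
  unfolding first_stage_def by (rule finite_subset[OF _ finite_binary_vectors]) blast

lemma first_stage_nonempty: "first_stage p \<noteq> {}"
proof -
  have "0 \<in> first_stage p"
    by (simp add: first_stage_def binary_vectors_def)
  then show ?thesis
    by blast
qed

lemma finite_second_stage: "finite (second_stage p x)"
  unfolding second_stage_def by (rule finite_subset[OF _ finite_binary_vectors]) blast

lemma second_stage_nonempty:
  fixes x :: "real ^ 'n::finite"
  assumes "x \<in> first_stage p" and "p \<le> CARD('n)"
  shows "second_stage p x \<noteq> {}"
proof -
  define S where "S = {i. x $ i = 1}"
  have x01: "x $ i = (if i \<in> S then 1 else 0)" for i
    using assms(1) unfolding first_stage_def binary_vectors_def S_def by auto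
  have sum_x: "(\<Sum>i\<in>UNIV. x $ i) = real (card S)"
    by (simp add: x01 sum.If_cases)
  then have le: "card S \<le> p"
    using assms(1) by (simp add: first_stage_def)
  have "p - card S \<le> card (- S)"
    using assms(2) by (simp add: card_Diff_subset Compl_eq_Diff_UNIV)
  then obtain T where T: "T \<subseteq> - S" "card T = p - card S"
    by (meson obtain_subset_with_card_n)
  define y :: "real ^ 'n" where "y = (\<chi> i. if i \<in> T then 1 else 0)"
  have "(\<Sum>i\<in>UNIV. y $ i) = real (card T)"
    by (simp add: y_def sum.If_cases)
  then have "y \<in> second_stage p x"
    using T le sum_x
    by (auto simp: second_stage_def binary_vectors_def sum.distrib y_def x01)
  then show ?thesis
    by blast
qed

lemma finite_discrete_uncertainty: "finite (discrete_uncertainty c d \<Gamma>)"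
proof (rule finite_subset)
  show "discrete_uncertainty c d \<Gamma> \<subseteq> (\<lambda>\<delta>. c + \<delta>) ` {\<delta>. \<forall>i. \<delta> $ i \<in> {0, d $ i}}"
    unfolding discrete_uncertainty_def by blast
  show "finite ((\<lambda>\<delta>. c + \<delta>) ` {\<delta>. \<forall>i. \<delta> $ i \<in> {0, d $ i}})"
    by (intro finite_imageI finite_vec_prod) simp
qed

lemma nominal_in_discrete_uncertainty:
  assumes "0 \<le> \<Gamma>"
  shows "c \<in> discrete_uncertainty c d \<Gamma>"
proof -
  have "{i. (0 :: real ^ 'a) $ i = d $ i \<and> d $ i \<noteq> 0} = {}"
    by auto
  then show ?thesis
    unfolding discrete_uncertainty_def using assms
    by (intro CollectI exI[of _ "0 :: real ^ 'a"]) (simp only: card.empty, simp)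
qed

end

theory Submission
  imports Defs
begin

text \<open>
  Every scenario $c$ satisfies $c \le \frac{1}{\alpha} \underline{c}$, and $\underline{c}$ is
  itself a scenario because $\Gamma \ge 0$.  Hence, for every first-stage solution, the robust
  cost lies between the nominal cost and $\frac{1}{\alpha}$ times the nominal cost, so a minimizer
  of the nominal cost minimizes the robust cost up to the factor $\frac{1}{\alpha}$.
\<close>

lemma inner_vec_mono:
  fixes a b y :: "real ^ 'n::finite"
  assumes "\<And>i. a $ i \<le> b $ i" and "\<And>i. 0 \<le> y $ i"
  shows "a \<bullet> y \<le> b \<bullet> y"
  unfolding inner_vec_def using assms by (auto intro!: sum_mono mult_right_mono)

lemma binary_vectors_nonneg: "x \<in> binary_vectors \<Longrightarrow> 0 \<le> x $ i"
  unfolding binary_vectors_def by (smt (verit) insertE mem_Collect_eq singletonD)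

lemma discrete_uncertainty_le:
  assumes "c \<in> discrete_uncertainty c_lo d \<Gamma>" and "\<And>i. 0 \<le> d $ i"
  shows "c $ i \<le> c_lo $ i + d $ i"
proof -
  obtain \<delta> where "c = c_lo + \<delta>" and "\<delta> $ i \<in> {0, d $ i}"
    using assms(1) unfolding discrete_uncertainty_def by blast
  then show ?thesis
    using assms(2)[of i] by auto
qed

text \<open>An optimal completion \<open>y\<close> for \<open>c\<close> is still feasible under
  \<open>c'\<close>, and since \<open>y\<close> has no negative entries, its cost there is at most
  \<open>k\<close> times its cost under \<open>c\<close>. The first-stage term absorbs the factor
  because \<open>C \<bullet> x\<close> is nonnegative and \<open>k\<close> is at least 1.\<close>

lemma two_stage_cost_scale:
  fixes C c c' x :: "real ^ 'n::finite"
  assumes "x \<in> first_stage p" and "p \<le> CARD('n)"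
    and "\<And>i. 0 \<le> C $ i" and "1 \<le> k" and "\<And>i. c' $ i \<le> k * c $ i"
  shows "two_stage_cost p C c' x \<le> k * two_stage_cost p C c x"
proof -
  let ?Y = "second_stage p x"
  have fin: "finite ((\<lambda>y. a \<bullet> y) ` ?Y)" for a
    by (simp add: finite_second_stage)
  obtain y where y: "y \<in> ?Y" and min: "(MIN y\<in>?Y. c \<bullet> y) = c \<bullet> y"
    using Min_in[OF fin, of c] second_stage_nonempty[OF assms(1,2)] by auto
  have "0 \<le> C \<bullet> x"
    using inner_vec_mono[of 0 C x] assms(1,3) binary_vectors_nonneg
    by (auto simp: first_stage_def)
  then have first: "C \<bullet> x \<le> k * (C \<bullet> x)"
    using mult_right_mono[OF \<open>1 \<le> k\<close>] by force
  have "(MIN y\<in>?Y. c' \<bullet> y) \<le> c' \<bullet> y"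
    using y fin by (intro Min_le) auto
  also have "\<dots> \<le> (k *\<^sub>R c) \<bullet> y"
    using y assms(5) by (intro inner_vec_mono) (auto simp: second_stage_def binary_vectors_nonneg)
  finally show ?thesis
    using first min by (simp add: two_stage_cost_def algebra_simps)
qed

text \<open>The first-stage cost does not depend on the scenario, so it moves inside the maximum.
  Robust costs can then be bounded scenario by scenario.\<close>

lemma robust_two_stage_cost_eq:
  assumes "finite U" and "U \<noteq> {}"
  shows "robust_two_stage_cost p C U x = (MAX c\<in>U. two_stage_cost p C c x)"
  unfolding robust_two_stage_cost_def two_stage_cost_def
  using Max_add_commute[OF assms, of "\<lambda>c. MIN y\<in>second_stage p x. c \<bullet> y" "C \<bullet> x"]
  by (simp only: add.commute)

theorem proposition19:
  fixes C c_lo c_hi x_hat :: "real ^ 'n::finite"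
    and p :: nat
    and \<Gamma> \<alpha> :: real
  assumes "1 \<le> p" and "p \<le> CARD('n)"
    and "\<And>i. 0 \<le> C $ i"
    and "\<And>i. 0 \<le> c_lo $ i"
    and "\<And>i. c_lo $ i \<le> c_hi $ i"
    and "0 \<le> \<Gamma>"
    and "0 < \<alpha>" and "\<alpha> \<le> 1"
    and "\<And>i. \<alpha> * c_hi $ i \<le> c_lo $ i"
    and "is_arg_min (two_stage_cost p C c_lo) (\<lambda>x. x \<in> first_stage p) x_hat"
  shows "robust_two_stage_cost p C (discrete_uncertainty c_lo (c_hi - c_lo) \<Gamma>) x_hat
    \<le> 1 / \<alpha> * (MIN x\<in>first_stage p.
        robust_two_stage_cost p C (discrete_uncertainty c_lo (c_hi - c_lo) \<Gamma>) x)"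
proof -
  let ?U = "discrete_uncertainty c_lo (c_hi - c_lo) \<Gamma>"
  let ?R = "robust_two_stage_cost p C ?U"
  let ?T = "two_stage_cost p C c_lo"
  \<comment> \<open>This membership also shows that the scenario set is nonempty, which the maxima
    over it require.\<close>
  have lo: "c_lo \<in> ?U"
    using \<open>0 \<le> \<Gamma>\<close> by (rule nominal_in_discrete_uncertainty)
  have finU: "finite ?U"
    by (rule finite_discrete_uncertainty)
  have R: "?R x = (MAX c\<in>?U. two_stage_cost p C c x)" for x
    using finU lo by (intro robust_two_stage_cost_eq) auto
  have xh: "x_hat \<in> first_stage p" and opt: "\<And>x. x \<in> first_stage p \<Longrightarrow> ?T x_hat \<le> ?T x"
    using assms(10) by (auto simp: is_arg_min_linorder)
  have scen: "c $ i \<le> 1 / \<alpha> * c_lo $ i" if "c \<in> ?U" for c i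
  proof -
    have "c $ i \<le> c_hi $ i"
      using discrete_uncertainty_le[OF that, of i] assms(5) by simp
    also have "\<dots> \<le> 1 / \<alpha> * c_lo $ i"
      using assms(9)[of i] \<open>0 < \<alpha>\<close> by (simp add: field_simps)
    finally show ?thesis .
  qed
  \<comment> \<open>The scaling factor is \<open>k = 1 / \<alpha>\<close>, which is at least 1
    because \<alpha> \<le> 1.\<close>
  have "two_stage_cost p C c x_hat \<le> 1 / \<alpha> * ?T x_hat" if "c \<in> ?U" for c
    using \<open>0 < \<alpha>\<close> \<open>\<alpha> \<le> 1\<close> scen[OF that] by (intro two_stage_cost_scale xh assms(2,3)) auto
  then have upper: "?R x_hat \<le> 1 / \<alpha> * ?T x_hat"
    unfolding R using finU lo by (intro Max.boundedI) auto
  \<comment> \<open>The nominal costs form one of the scenarios in the maximum.\<close>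
  have lower: "?T x \<le> ?R x" for x
    unfolding R using finU lo by (intro Max_ge) auto
  \<comment> \<open>For each feasible \<open>x\<close>, nominal optimality and \<open>lower\<close>
    chain to \<open>?T x_hat \<le> ?T x \<le> ?R x\<close>.\<close>
  have "?T x_hat \<le> (MIN x\<in>first_stage p. ?R x)"
    using opt lower
    by (intro Min.boundedI finite_imageI finite_first_stage)
       (auto simp: first_stage_nonempty intro: order_trans)
  then have "1 / \<alpha> * ?T x_hat \<le> 1 / \<alpha> * (MIN x\<in>first_stage p. ?R x)"
    using \<open>0 < \<alpha>\<close> by (intro mult_left_mono) auto
  with upper show ?thesis
    by (rule order_trans)
qed

end
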